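(* Let $M>1$, $\mathcal R=[1/M,M]$, and $\epsilon\in(0,1]$. Let $P_q$ be any extended polyhedron with $q$ variables (including the variables $x,\nu$) and constraints such that $$\operatorname{hyp}\log(-\epsilon)\subseteq\operatorname{Proj}_{(x,\nu)}(P_q)\subseteq\operatorname{hyp}\log(\epsilon).$$ Then $q=\Omega\big(\log\log(M)+\log(1/\epsilon)\big)$.
   Context: For $\alpha\in\mathbb R$, $\operatorname{hyp}\log(\alpha)=\{(x,\nu)\in\mathcal R\times\mathbb R:\log(x)\ge\nu-\alpha\}$. An extended polyhedron with $q$ variables and constraints is a set defined by linear inequalities in real variables that include $x,\nu$ and possibly additional variables, where the number of variables together with the number of linear constraints is $q$; $\operatorname{Proj}_{(x,\nu)}$ is the projection onto the $(x,\nu)$ coordinates. $\Omega(\cdot)$ is the usual asymptotic notation, describing growth in $M$ and $1/\epsilon$. *)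

theory Defs
  imports Complex_Main "Jordan_Normal_Form.Matrix"
begin

text \<open>The interval \<open>[1/M, M]\<close> enters through the parameter \<open>M\<close>; \<open>log\<close> is the natural
  logarithm.\<close>

definition hyp_log :: "real \<Rightarrow> real \<Rightarrow> (real \<times> real) set" where
  "hyp_log M \<alpha> = {(x, \<nu>). x \<in> {1 / M..M} \<and> ln x \<ge> \<nu> - \<alpha>}"

text \<open>The order on vectors is componentwise, so each row of \<open>A\<close> is one linear inequality.\<close>

definition polyhedron_of :: "real mat \<Rightarrow> real vec \<Rightarrow> real vec set" where
  "polyhedron_of A b = {y \<in> carrier_vec (dim_col A). A *\<^sub>v y \<le> b}"

text \<open>There are \<open>n\<close> variables and \<open>m\<close> constraints. Coordinates 0 and 1 are the variables \<open>x\<close> and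
  \<open>\<nu>\<close>, which are always present; the other \<open>n - 2\<close> coordinates are the additional variables.\<close>

definition extended_polyhedron :: "nat \<Rightarrow> real vec set \<Rightarrow> bool" where
  "extended_polyhedron q P \<longleftrightarrow>
    (\<exists>n m A b. 2 \<le> n \<and> n + m = q \<and> A \<in> carrier_mat m n \<and> b \<in> carrier_vec m \<and>
      P = polyhedron_of A b)"

definition Proj_x_nu :: "real vec set \<Rightarrow> (real \<times> real) set" where
  "Proj_x_nu P = (\<lambda>y. (y $ 0, y $ 1)) ` P"

text \<open>The asymptotic bound \<open>q = \<Omega>(log log M + log (1/\<epsilon>))\<close> is read with one constant for all \<open>M \<ge> M\<^sub>0\<close>
  and all \<open>\<epsilon> \<in> (0, 1]\<close>, for an arbitrary \<open>M\<^sub>0 > 1\<close>. A constant valid for all \<open>M > 1\<close> does not exist: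
  if \<open>M = exp (sqrt \<epsilon>)\<close>, then \<open>{(x, \<nu>). 1/M \<le> x \<le> M, \<nu> \<le> x - 1}\<close> lies between the two hypographs with
  \<open>q = 5\<close>, whereas \<open>log log M + log (1/\<epsilon>) = log (1/\<epsilon>) / 2\<close>.\<close>

end

theory Submission imports Defs begin

text \<open>Call a point of the extended polyhedron optimal if it maximises \<open>\<nu>\<close> for its value of \<open>x\<close>; optimality
  depends only on which of the \<open>m\<close> constraints are tight. If optimal points over \<open>x = a\<close> and \<open>x = b\<close>
  have the same tight constraints, then their midpoint is optimal as well, so the approximation of
  \<open>log\<close> is affine between \<open>a\<close> and \<open>b\<close>, and comparing the arithmetic with the geometric mean gives
  \<open>cosh (log (b/a) / 2) \<le> exp (2 \<epsilon>)\<close>. Hence points of \<open>[1/M, M]\<close> whose logarithms are \<open>12 \<surd>\<epsilon>\<close> apart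
  have different tight sets, so \<open>2^m > log M / (6 \<surd>\<epsilon>)\<close>.\<close>

subsection \<open>Parametric linear programs\<close>

text \<open>Points are functions on \<open>nat\<close> of which only the first \<open>n\<close>
  values enter, so no dimension conditions accompany the perturbations below.\<close>

definition lin :: "nat \<Rightarrow> (nat \<Rightarrow> real) \<Rightarrow> (nat \<Rightarrow> real) \<Rightarrow> real" where
  "lin n c y = (\<Sum>i<n. c i * y i)"

lemma lin_add_scale: "lin n c (\<lambda>i. y i + t * d i) = lin n c y + t * lin n c d"
  by (simp add: lin_def algebra_simps sum.distrib sum_distrib_left)

lemma lin_diff: "lin n c (\<lambda>i. y i - z i) = lin n c y - lin n c z"
  by (simp add: lin_def algebra_simps sum_subtractf)

lemma lin_minus: "lin n c (\<lambda>i. - y i) = - lin n c y"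
  by (simp add: lin_def sum_negf)

lemma lin_midpoint: "lin n c (\<lambda>i. (y i + z i) / 2) = (lin n c y + lin n c z) / 2"
  by (simp add: lin_def sum.distrib sum_divide_distrib distrib_left add_divide_distrib)

locale inequality_system =
  fixes n m :: nat and A :: "nat \<Rightarrow> nat \<Rightarrow> real" and b :: "nat \<Rightarrow> real"
begin

definition feasible :: "(nat \<Rightarrow> real) \<Rightarrow> bool" where
  "feasible y \<longleftrightarrow> (\<forall>j<m. lin n (A j) y \<le> b j)"

definition tight :: "(nat \<Rightarrow> real) \<Rightarrow> nat set" where
  "tight y = {j. j < m \<and> lin n (A j) y = b j}"

definition optimal :: "(nat \<Rightarrow> real) \<Rightarrow> bool" where
  "optimal y \<longleftrightarrow> feasible y \<and> (\<forall>z. feasible z \<longrightarrow> z 0 = y 0 \<longrightarrow> z 1 \<le> y 1)"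

text \<open>The tight constraints and the value of coordinate 0 determine coordinate 1.\<close>

definition basic :: "(nat \<Rightarrow> real) \<Rightarrow> bool" where
  "basic y \<longleftrightarrow> (\<forall>d. d 0 = 0 \<longrightarrow> (\<forall>j\<in>tight y. lin n (A j) d = 0) \<longrightarrow> d 1 = 0)"

lemma tight_subset: "tight y \<subseteq> {..<m}"
  by (auto simp: tight_def)

lemma finite_tight: "finite (tight y)"
  using tight_subset finite_subset by blast

text \<open>This is the ratio test of the simplex method: the step length is the least ratio of
  slack to growth rate over the constraints that increase along \<open>d\<close>, and a minimiser
  becomes tight.\<close>

lemma ray_hits_constraint:
  assumes y: "feasible y" and "\<exists>j<m. lin n (A j) d > 0"
  obtains t j where "t \<ge> 0" "feasible (\<lambda>i. y i + t * d i)" "j < m" "lin n (A j) d > 0"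
    "j \<in> tight (\<lambda>i. y i + t * d i)"
proof -
  define J where "J = {j. j < m \<and> lin n (A j) d > 0}"
  define r where "r j = (b j - lin n (A j) y) / lin n (A j) d" for j
  have J: "finite (r ` J)" "r ` J \<noteq> {}"
    using assms(2) by (auto simp: J_def)
  define t where "t = Min (r ` J)"
  have "t \<in> r ` J"
    unfolding t_def using J by (rule Min_in)
  then obtain j where j: "j \<in> J" "t = r j" by auto
  have t0: "t \<ge> 0"
    using j y by (auto simp: r_def J_def feasible_def)
  have feas: "feasible (\<lambda>i. y i + t * d i)"
    unfolding feasible_def lin_add_scale
  proof (intro allI impI)
    fix k assume k: "k < m"
    show "lin n (A k) y + t * lin n (A k) d \<le> b k"
    proof (cases "lin n (A k) d > 0")
      case True
      then have "t \<le> r k"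
        using J k by (auto simp: t_def J_def)
      then show ?thesis
        using True by (simp add: r_def field_simps)
    next
      case False
      then have "t * lin n (A k) d \<le> 0"
        using t0 by (simp add: mult_nonneg_nonpos)
      then show ?thesis
        using y k by (fastforce simp: feasible_def)
    qed
  qed
  have "j \<in> tight (\<lambda>i. y i + t * d i)"
    using j by (auto simp: tight_def lin_add_scale J_def) (simp add: r_def)
  with t0 feas j show ?thesis
    by (intro that[of t j]) (auto simp: J_def)
qed

lemma improving_direction_blocked:
  assumes y: "feasible y" and bd: "\<And>z. feasible z \<Longrightarrow> z 0 = y 0 \<Longrightarrow> z 1 \<le> B"
    and d: "d 0 = 0" "d 1 > 0"
  shows "\<exists>j<m. lin n (A j) d > 0"
proof (rule ccontr)
  assume "\<not> ?thesis"
  then have neg: "lin n (A j) d \<le> 0" if "j < m" for j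
    using that by force
  \<comment> \<open>The step is long enough to reach height \<open>B + 1\<close>.\<close>
  define t where "t = (B - y 1 + 1) / d 1"
  have "y 1 \<le> B"
    using bd y by blast
  then have t: "t \<ge> 0"
    using d by (simp add: t_def)
  have "feasible (\<lambda>i. y i + t * d i)"
    unfolding feasible_def lin_add_scale
  proof (intro allI impI)
    fix j assume "j < m"
    then have "t * lin n (A j) d \<le> 0" "lin n (A j) y \<le> b j"
      using t neg y by (auto simp: mult_nonneg_nonpos feasible_def)
    then show "lin n (A j) y + t * lin n (A j) d \<le> b j" by linarith
  qed
  then have "y 1 + t * d 1 \<le> B"
    using bd[of "\<lambda>i. y i + t * d i"] d by simp
  then show False
    using d by (simp add: t_def)
qed

text \<open>While a point is not basic, some direction fixes coordinate 0 and all tight constraints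
  but raises coordinate 1. Following it until another constraint blocks enlarges the tight set,
  which can happen at most \<open>m\<close> times.\<close>

lemma basic_dominates:
  assumes "feasible y" "\<And>z. feasible z \<Longrightarrow> z 0 = y 0 \<Longrightarrow> z 1 \<le> B"
  shows "\<exists>z. feasible z \<and> basic z \<and> z 0 = y 0 \<and> z 1 \<ge> y 1"
  using assms
proof (induction "m - card (tight y)" arbitrary: y rule: less_induct)
  case less
  show ?case
  proof (cases "basic y")
    case True
    then show ?thesis using less.prems by blast
  next
    case False
    then obtain e where e: "e 0 = 0" "\<And>j. j \<in> tight y \<Longrightarrow> lin n (A j) e = 0" "e 1 \<noteq> 0"
      unfolding basic_def by blast
    obtain d where d: "d 0 = 0" "\<And>j. j \<in> tight y \<Longrightarrow> lin n (A j) d = 0" "d 1 > 0"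
    proof (cases "e 1 > 0")
      case True
      then show ?thesis using that e by blast
    next
      case False
      then show ?thesis
        using that[of "\<lambda>i. - e i"] e by (simp add: lin_minus)
    qed
    have "\<exists>j<m. lin n (A j) d > 0"
      using improving_direction_blocked less.prems d by blast
    then obtain t j where t: "t \<ge> 0" "feasible (\<lambda>i. y i + t * d i)" "j < m"
        "lin n (A j) d > 0" "j \<in> tight (\<lambda>i. y i + t * d i)"
      using ray_hits_constraint less.prems(1) by blast
    define z where "z = (\<lambda>i. y i + t * d i)"
    have "tight y \<subseteq> tight z"
      using d(2) by (auto simp: z_def tight_def lin_add_scale)
    \<comment> \<open>The constraint \<open>j\<close> is new because it grows strictly along
      \<open>d\<close>, whereas those tight at \<open>y\<close> are constant along it.\<close>
    moreover have "j \<in> tight z - tight y"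
      using t d(2)[of j] by (auto simp: z_def)
    ultimately have "tight y \<subset> tight z" by blast
    then have "card (tight y) < card (tight z)"
      using finite_tight by (simp add: psubset_card_mono)
    moreover have "card (tight z) \<le> m"
      using card_mono[OF _ tight_subset, of z] by simp
    ultimately have "m - card (tight z) < m - card (tight y)" by linarith
    moreover have z: "feasible z" "z 0 = y 0" "z 1 \<ge> y 1"
      using t d by (auto simp: z_def)
    ultimately obtain w where "feasible w" "basic w" "w 0 = z 0" "w 1 \<ge> z 1"
      using less.hyps[of z] less.prems(2) by auto
    then show ?thesis
      using z by (intro exI[of _ w]) auto
  qed
qed

text \<open>The supremum is attained by finiteness rather than compactness: basic points over the
  same \<open>x\<close> with equal tight sets have equal \<open>\<nu>\<close>, so basic points yield
  finitely many heights. The largest one is optimal because basic points dominate all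
  others.\<close>

lemma optimal_exists:
  assumes "feasible y" and bd: "\<And>z. feasible z \<Longrightarrow> z 0 = y 0 \<Longrightarrow> z 1 \<le> B"
  shows "\<exists>z. optimal z \<and> z 0 = y 0"
proof -
  define S where "S = {z. feasible z \<and> basic z \<and> z 0 = y 0}"
  have eq: "z 1 = z' 1" if "z \<in> S" "z' \<in> S" "tight z = tight z'" for z z'
  proof -
    have "lin n (A j) (\<lambda>i. z i - z' i) = 0" if "j \<in> tight z" for j
    proof -
      have "j \<in> tight z'"
        using that \<open>tight z = tight z'\<close> by blast
      with that show ?thesis
        by (simp add: lin_diff tight_def)
    qed
    moreover have "basic z" "z 0 - z' 0 = 0"
      using that by (auto simp: S_def)
    ultimately have "(\<lambda>i. z i - z' i) 1 = 0"
      unfolding basic_def by (elim allE[of _ "\<lambda>i. z i - z' i"]) simp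
    then show ?thesis by simp
  qed
  \<comment> \<open>The common height of the points of \<open>S\<close> with tight set
    \<open>T\<close>, and an arbitrary number if there are none.\<close>
  define g where "g T = (SOME v. \<exists>z\<in>S. tight z = T \<and> v = z 1)" for T
  have "(\<lambda>z. z 1) ` S \<subseteq> g ` Pow {..<m}"
  proof
    fix v assume "v \<in> (\<lambda>z. z 1) ` S"
    then obtain z where z: "z \<in> S" "v = z 1" by auto
    have "\<exists>z'\<in>S. tight z' = tight z \<and> g (tight z) = z' 1"
      unfolding g_def by (rule someI_ex) (use z in blast)
    then have "g (tight z) = v"
      using eq z by metis
    then show "v \<in> g ` Pow {..<m}"
      using tight_subset[of z] by blast
  qed
  then have fin: "finite ((\<lambda>z. z 1) ` S)"
    using finite_subset by blast
  have ne: "(\<lambda>z. z 1) ` S \<noteq> {}"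
    using basic_dominates[of y B] assms by (auto simp: S_def)
  obtain z where z: "z \<in> S" "z 1 = Max ((\<lambda>z. z 1) ` S)"
    using Max_in[OF fin ne] by auto
  have "w 1 \<le> z 1" if w: "feasible w" "w 0 = z 0" for w
  proof -
    have "w 0 = y 0"
      using w z by (simp add: S_def)
    then obtain u where u: "feasible u" "basic u" "u 0 = y 0" "u 1 \<ge> w 1"
      using basic_dominates[of w B] w bd by auto
    then have "u 1 \<le> z 1"
      using z(2) fin by (auto simp: S_def)
    with u show ?thesis by simp
  qed
  then show ?thesis
    using z by (auto simp: optimal_def S_def)
qed

text \<open>If \<open>z\<close> were higher than the midpoint, a short step from \<open>y\<close> in
  the direction from the midpoint to \<open>z\<close> would improve \<open>y\<close>. Constraints
  tight at \<open>y\<close> are tight at the midpoint too, so they do not grow towards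
  \<open>z\<close>; the others have slack at \<open>y\<close>.\<close>

lemma midpoint_optimal:
  assumes y: "optimal y" and sub: "tight y \<subseteq> tight y'"
    and z: "feasible z" "z 0 = (y 0 + y' 0) / 2"
  shows "z 1 \<le> (y 1 + y' 1) / 2"
proof (rule ccontr)
  assume neg: "\<not> ?thesis"
  define d where "d = (\<lambda>i. z i - (y i + y' i) / 2)"
  have ld: "lin n (A j) d = lin n (A j) z - (lin n (A j) y + lin n (A j) y') / 2" for j
    unfolding d_def lin_diff lin_midpoint ..
  have feas: "lin n (A j) y \<le> b j" if "j < m" for j
    using y that by (auto simp: optimal_def feasible_def)
  have "\<forall>\<^sub>F t in at_right 0. lin n (A j) y + t * lin n (A j) d \<le> b j" if j: "j < m" for j
  proof (cases "j \<in> tight y")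
    case True
    then have "lin n (A j) d \<le> 0"
      using sub z(1) j ld[of j] by (auto simp: tight_def feasible_def)
    then have "lin n (A j) y + t * lin n (A j) d \<le> b j" if "t > 0" for t
      using feas[OF j] mult_nonneg_nonpos[of t "lin n (A j) d"] that by linarith
    then show ?thesis
      by (intro eventually_at_rightI[of 0 1]) auto
  next
    case False
    then have "lin n (A j) y < b j"
      using feas[OF j] j by (auto simp: tight_def less_le)
    moreover have "((\<lambda>t. lin n (A j) y + t * lin n (A j) d) \<longlongrightarrow>
        lin n (A j) y + 0 * lin n (A j) d) (at_right 0)"
      by (intro tendsto_intros)
    ultimately have "\<forall>\<^sub>F t in at_right 0. lin n (A j) y + t * lin n (A j) d < b j"
      by (auto intro: order_tendstoD(2))
    then show ?thesis
      by eventually_elim simp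
  qed
  then have "\<forall>\<^sub>F t in at_right 0. \<forall>j\<in>{..<m}. lin n (A j) y + t * lin n (A j) d \<le> b j"
    by (intro eventually_ball_finite) auto
  moreover have "\<forall>\<^sub>F t in at_right (0::real). t > 0"
    by (rule eventually_at_right_less)
  ultimately have "\<forall>\<^sub>F t in at_right 0. t > 0 \<and> feasible (\<lambda>i. y i + t * d i)"
    by eventually_elim (auto simp: feasible_def lin_add_scale)
  then obtain t where t: "t > 0" "feasible (\<lambda>i. y i + t * d i)"
    using eventually_happens trivial_limit_at_right_real by blast
  have "y 1 + t * d 1 \<le> y 1"
    using y t(2) z(2) unfolding optimal_def d_def by auto
  moreover have "d 1 > 0"
    using neg by (simp add: d_def)
  ultimately show False
    using t(1) by (simp add: mult_le_0_iff)
qed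

end

subsection \<open>Affine approximation of the logarithm\<close>

text \<open>Averaging a quadratic bound for \<open>exp s\<close> with a linear one for
  \<open>exp (- s)\<close> gives the factor 1/4 in place of the sharp 1/2.\<close>

lemma cosh_lower_quadratic:
  fixes s :: real
  assumes "s \<ge> 0"
  shows "1 + s\<^sup>2 / 4 \<le> cosh s"
proof -
  have "1 + s + s\<^sup>2 / 2 \<le> exp s"
    using assms by (rule exp_lower_Taylor_quadratic)
  moreover have "1 - s \<le> exp (- s)"
    using exp_ge_add_one_self[of "- s"] by simp
  ultimately show ?thesis
    by (simp add: cosh_field_def field_simps)
qed

lemma exp_double_upper_linear:
  fixes e :: real
  assumes "0 \<le> e" "e \<le> 1"
  shows "exp (2 * e) \<le> 1 + 8 * e"
proof -
  have sq: "e\<^sup>2 \<le> e"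
    using assms by (simp add: power2_eq_square mult_left_le)
  have "exp e \<le> 1 + e + e\<^sup>2"
    using assms by (rule exp_bound)
  then have "exp e \<le> 1 + 2 * e"
    using sq by linarith
  then have "(exp e)\<^sup>2 \<le> (1 + 2 * e)\<^sup>2"
    by (intro power_mono) auto
  also have "\<dots> = 1 + 4 * e + 4 * e\<^sup>2"
    by (simp add: power2_eq_square algebra_simps)
  finally show ?thesis
    using sq by (simp add: exp_double)
qed

text \<open>The arithmetic mean of \<open>exp u\<close> and \<open>exp v\<close> is their geometric
  mean times \<open>cosh ((v - u) / 2)\<close>.\<close>

lemma ln_midpoint_gap:
  fixes u v e :: real
  assumes e: "0 < e" "e \<le> 1" and gap: "v - u \<ge> 12 * sqrt e"
  shows "ln ((exp u + exp v) / 2) > (u + v) / 2 + 2 * e"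
proof -
  define s where "s = (v - u) / 2"
  have s: "s \<ge> 6 * sqrt e"
    using gap by (simp add: s_def)
  then have "s \<ge> 0"
    using e by (meson order.trans mult_nonneg_nonneg real_sqrt_ge_zero less_imp_le zero_le_numeral)
  have "(6 * sqrt e)\<^sup>2 \<le> s\<^sup>2"
    using s e by (intro power_mono) auto
  then have "36 * e \<le> s\<^sup>2"
    using e by (simp add: power_mult_distrib)
  \<comment> \<open>The factor 12 in the gap pays off here: \<open>cosh s\<close> is at least
    \<open>1 + 9 * e\<close>, which exceeds \<open>1 + 8 * e\<close>.\<close>
  then have "exp (2 * e) < cosh s"
    using cosh_lower_quadratic[OF \<open>s \<ge> 0\<close>] exp_double_upper_linear[of e] e by linarith
  then have "exp ((u + v) / 2) * exp (2 * e) < exp ((u + v) / 2) * cosh s"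
    by simp
  also have "\<dots> = (exp ((u + v) / 2 + s) + exp ((u + v) / 2 - s)) / 2"
    unfolding cosh_field_def diff_conv_add_uminus exp_add by (simp add: algebra_simps)
  also have "(u + v) / 2 + s = v"
    by (simp add: s_def field_simps)
  also have "(u + v) / 2 - s = u"
    by (simp add: s_def field_simps)
  finally have "exp ((u + v) / 2 + 2 * e) < (exp u + exp v) / 2"
    by (simp add: exp_add mult.commute)
  moreover have "(exp u + exp v) / 2 > 0"
    by (simp add: add_pos_pos)
  ultimately show ?thesis
    by (metis exp_gt_zero ln_exp ln_less_cancel_iff)
qed

subsection \<open>Counting constraints\<close>

lemma mem_polyhedron_of_iff:
  assumes "A \<in> carrier_mat m n" "b \<in> carrier_vec m"
  shows "vec n y \<in> polyhedron_of A b \<longleftrightarrow>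
    inequality_system.feasible n m (\<lambda>j i. A $$ (j, i)) (\<lambda>j. b $ j) y"
  using assms
  by (auto simp: polyhedron_of_def inequality_system.feasible_def lin_def less_eq_vec_def
      scalar_prod_def atLeast0LessThan)

lemma Proj_x_nu_polyhedron_of:
  assumes "A \<in> carrier_mat m n" "b \<in> carrier_vec m" "2 \<le> n"
  shows "Proj_x_nu (polyhedron_of A b) =
    {(y 0, y 1) |y. inequality_system.feasible n m (\<lambda>j i. A $$ (j, i)) (\<lambda>j. b $ j) y}"
    (is "_ = ?R")
proof (intro equalityI subsetI)
  fix p assume "p \<in> Proj_x_nu (polyhedron_of A b)"
  then obtain w where w: "w \<in> polyhedron_of A b" "p = (w $ 0, w $ 1)"
    by (auto simp: Proj_x_nu_def)
  have "vec n (\<lambda>i. w $ i) = w"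
    using w assms by (auto simp: polyhedron_of_def)
  then show "p \<in> ?R"
    using w mem_polyhedron_of_iff[OF assms(1,2), of "\<lambda>i. w $ i"] by auto
next
  fix p assume "p \<in> ?R"
  then obtain y where y: "vec n y \<in> polyhedron_of A b" "p = (y 0, y 1)"
    using mem_polyhedron_of_iff[OF assms(1,2)] by blast
  then show "p \<in> Proj_x_nu (polyhedron_of A b)"
    using assms(3) by (auto simp: Proj_x_nu_def intro!: rev_image_eqI[of "vec n y"])
qed

lemma mem_hyp_log_exp:
  assumes "M > 1"
  shows "(exp u, \<nu>) \<in> hyp_log M \<alpha> \<longleftrightarrow> \<bar>u\<bar> \<le> ln M \<and> \<nu> \<le> u + \<alpha>"
proof -
  have "1 / M = exp (- ln M)" "M = exp (ln M)"
    using assms by (auto simp: exp_minus inverse_eq_divide)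
  then have "exp u \<in> {1 / M..M} \<longleftrightarrow> \<bar>u\<bar> \<le> ln M"
    by (metis abs_le_iff atLeastAtMost_iff exp_le_cancel_iff minus_le_iff)
  then show ?thesis
    by (auto simp: hyp_log_def algebra_simps)
qed

text \<open>A grid of spacing \<open>12 * sqrt \<epsilon>\<close> on the interval from
  \<open>- ln M\<close> to \<open>ln M\<close> of logarithms is mapped injectively to subsets of the
  \<open>m\<close> constraints.\<close>

lemma two_power_constraints_lower_bound:
  fixes M \<epsilon> :: real
  assumes M: "M > 1" and e: "0 < \<epsilon>" "\<epsilon> \<le> 1"
    and A: "A \<in> carrier_mat m n" "b \<in> carrier_vec m" "2 \<le> n"
    and lower: "hyp_log M (- \<epsilon>) \<subseteq> Proj_x_nu (polyhedron_of A b)"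
    and upper: "Proj_x_nu (polyhedron_of A b) \<subseteq> hyp_log M \<epsilon>"
  shows "ln M / (6 * sqrt \<epsilon>) < 2 ^ m"
proof -
  interpret inequality_system n m "\<lambda>j i. A $$ (j, i)" "\<lambda>j. b $ j" .
  have P: "Proj_x_nu (polyhedron_of A b) = {(y 0, y 1) |y. feasible y}"
    using A by (rule Proj_x_nu_polyhedron_of)
  have below: "y 1 \<le> u + \<epsilon>" if "feasible y" "y 0 = exp u" for y u
  proof -
    have "(y 0, y 1) \<in> hyp_log M \<epsilon>"
      using that upper P by blast
    then show ?thesis
      using that mem_hyp_log_exp[OF M] by simp
  qed
  have above: "\<exists>y. feasible y \<and> y 0 = exp u \<and> y 1 = u - \<epsilon>" if "\<bar>u\<bar> \<le> ln M" for u
  proof -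
    have "(exp u, u - \<epsilon>) \<in> {(y 0, y 1) |y. feasible y}"
      using that lower P mem_hyp_log_exp[OF M, of u "u - \<epsilon>" "- \<epsilon>"] by auto
    then show ?thesis by force
  qed
  have "\<exists>y. optimal y \<and> y 0 = exp u" if u: "\<bar>u\<bar> \<le> ln M" for u
  proof -
    obtain y where "feasible y" "y 0 = exp u"
      using above u by blast
    then show ?thesis
      using optimal_exists[of y "u + \<epsilon>"] below by auto
  qed
  then obtain Y where Y: "\<And>u. \<bar>u\<bar> \<le> ln M \<Longrightarrow> optimal (Y u) \<and> Y u 0 = exp u"
    by metis
  have distinct: "tight (Y u) \<noteq> tight (Y v)"
    if u: "\<bar>u\<bar> \<le> ln M" and v: "\<bar>v\<bar> \<le> ln M" and gap: "v - u \<ge> 12 * sqrt \<epsilon>" for u v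
  proof
    assume eq: "tight (Y u) = tight (Y v)"
    \<comment> \<open>Over the mean of \<open>exp u\<close> and \<open>exp v\<close>, the lower
      inclusion gives a point of height \<open>w - \<epsilon>\<close>, while equal tight sets and
      the upper inclusion cap the height at \<open>(u + v) / 2 + \<epsilon>\<close>. The two errors
      add up to \<open>2 * \<epsilon>\<close>.\<close>
    define w where "w = ln ((exp u + exp v) / 2)"
    have w: "exp w = (exp u + exp v) / 2"
      by (simp add: w_def add_pos_pos)
    have "u \<le> v"
      using gap e by (smt (verit) real_sqrt_ge_zero)
    then have "exp u \<le> exp w" "exp w \<le> exp v"
      by (auto simp: w)
    then have "\<bar>w\<bar> \<le> ln M"
      using u v by auto
    then obtain z where z: "feasible z" "z 0 = exp w" "z 1 = w - \<epsilon>"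
      using above by blast
    have "z 1 \<le> (Y u 1 + Y v 1) / 2"
      using Y[OF u] Y[OF v] eq z w by (intro midpoint_optimal) auto
    moreover have "Y u 1 \<le> u + \<epsilon>" "Y v 1 \<le> v + \<epsilon>"
      using Y[OF u] Y[OF v] below by (auto simp: optimal_def)
    ultimately have "w \<le> (u + v) / 2 + 2 * \<epsilon>"
      using z by (simp add: field_simps)
    then show False
      using ln_midpoint_gap[OF e gap] by (simp add: w_def)
  qed
  define \<delta> where "\<delta> = 12 * sqrt \<epsilon>"
  have \<delta>: "\<delta> > 0"
    using e by (simp add: \<delta>_def)
  define N where "N = nat \<lfloor>2 * ln M / \<delta>\<rfloor>"
  have "0 \<le> 2 * ln M / \<delta>"
    using M \<delta> by simp
  then have N: "real N \<le> 2 * ln M / \<delta>" "2 * ln M / \<delta> < real N + 1"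
    unfolding N_def by linarith+
  define u where "u i = - ln M + real i * \<delta>" for i
  have u: "\<bar>u i\<bar> \<le> ln M" if "i \<le> N" for i
  proof -
    have "real i \<le> 2 * ln M / \<delta>"
      using that N(1) by linarith
    then have "real i * \<delta> \<le> 2 * ln M"
      using \<delta> by (simp add: field_simps)
    moreover have "0 \<le> real i * \<delta>"
      using \<delta> by simp
    ultimately show ?thesis
      by (simp add: u_def)
  qed
  have ne: "tight (Y (u i)) \<noteq> tight (Y (u k))" if "i < k" "k \<le> N" for i k
  proof -
    have "1 * \<delta> \<le> (real k - real i) * \<delta>"
      using that \<delta> by (intro mult_right_mono) auto
    then show ?thesis
      using that by (intro distinct u) (auto simp: u_def \<delta>_def algebra_simps)
  qed
  have "inj_on (\<lambda>i. tight (Y (u i))) {..N}"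
    by (rule linorder_inj_onI) (use ne in auto)
  moreover have "(\<lambda>i. tight (Y (u i))) ` {..N} \<subseteq> Pow {..<m}"
    using tight_subset by blast
  \<comment> \<open>The grid has \<open>N + 1\<close> points, and this extra one makes up for the
    rounding in \<open>N\<close>.\<close>
  ultimately have "card {..N} \<le> card (Pow {..<m})"
    by (intro card_inj_on_le) auto
  then have "N + 1 \<le> 2 ^ m"
    by (simp add: card_Pow)
  then have "real (N + 1) \<le> 2 ^ m"
    by (metis of_nat_le_iff of_nat_numeral of_nat_power)
  moreover have "ln M / (6 * sqrt \<epsilon>) = 2 * ln M / \<delta>"
    by (simp add: \<delta>_def)
  ultimately show ?thesis
    using N(2) by linarith
qed

theorem theorem7:
  fixes M\<^sub>0 :: real
  assumes "M\<^sub>0 > 1"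
  shows "\<exists>c>0. \<forall>M \<epsilon> :: real. \<forall>q P.
    M \<ge> M\<^sub>0 \<longrightarrow> \<epsilon> \<in> {0<..1} \<longrightarrow> extended_polyhedron q P \<longrightarrow>
    hyp_log M (- \<epsilon>) \<subseteq> Proj_x_nu P \<longrightarrow> Proj_x_nu P \<subseteq> hyp_log M \<epsilon> \<longrightarrow>
    real q \<ge> c * (ln (ln M) + ln (1 / \<epsilon>))"
proof -
  \<comment> \<open>\<open>K\<close> collects the additive losses: the factor 6 in the counting
    bound and a possibly negative \<open>ln (ln M\<^sub>0)\<close>, halved because the inequality is
    doubled later.\<close>
  define K where "K = ln 6 + \<bar>ln (ln M\<^sub>0)\<bar> / 2"
  define C where "C = 2 * ln 2 + K"
  have "ln 6 > (0::real)" "ln 2 > (0::real)" by auto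
  then have K: "K > 0" and C: "C > 0"
    unfolding C_def K_def by linarith+
  have main: "real q \<ge> 1 / C * (ln (ln M) + ln (1 / \<epsilon>))"
    if M: "M \<ge> M\<^sub>0" and e: "\<epsilon> \<in> {0<..1}" and ext: "extended_polyhedron q P"
      and lower: "hyp_log M (- \<epsilon>) \<subseteq> Proj_x_nu P" and upper: "Proj_x_nu P \<subseteq> hyp_log M \<epsilon>"
    for M \<epsilon> :: real and q P
  proof -
    obtain n m A b where A: "2 \<le> n" "n + m = q" "A \<in> carrier_mat m n" "b \<in> carrier_vec m"
        "P = polyhedron_of A b"
      using ext by (auto simp: extended_polyhedron_def)
    have e': "0 < \<epsilon>" "\<epsilon> \<le> 1" and M1: "M > 1"
      using e M assms by auto
    have lnM: "0 < ln M\<^sub>0" "ln M\<^sub>0 \<le> ln M" "0 < ln M"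
      using M M1 assms by auto
    have "ln M / (6 * sqrt \<epsilon>) < 2 ^ m"
      using two_power_constraints_lower_bound[OF M1 e' A(3,4,1)] lower upper A(5) by simp
    moreover have "0 < ln M / (6 * sqrt \<epsilon>)"
      using lnM e' by simp
    ultimately have "ln (ln M / (6 * sqrt \<epsilon>)) < ln (2 ^ m)"
      by simp
    also have "ln (2 ^ m) = real m * ln (2::real)"
      by (simp add: ln_realpow)
    also have "ln (ln M / (6 * sqrt \<epsilon>)) = ln (ln M) - (ln 6 + ln \<epsilon> / 2)"
      using lnM e' by (simp add: ln_div ln_mult ln_sqrt)
    finally have "ln (ln M) + ln (1 / \<epsilon>) / 2 < real m * ln 2 + ln 6"
      using e' by (simp add: ln_div)
    moreover have "ln (ln M\<^sub>0) \<le> ln (ln M)"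
      using lnM by simp
    ultimately have "ln (ln M) + ln (1 / \<epsilon>) \<le> 2 * (real m * ln 2) + 2 * K"
      using abs_ge_minus_self[of "ln (ln M\<^sub>0)"] unfolding K_def by argo
    \<comment> \<open>The variables \<open>x\<close> and \<open>\<nu>\<close> alone force
      \<open>q\<close> to be at least 2, so the additive constant \<open>2 * K\<close> is absorbed
      into \<open>real q * K\<close>.\<close>
    also have "\<dots> \<le> 2 * (real q * ln 2) + real q * K"
      using A(1,2) K by (intro add_mono mult_left_mono mult_right_mono) auto
    also have "\<dots> = real q * C"
      by (simp add: C_def algebra_simps)
    finally show ?thesis
      using C by (simp add: field_simps)
  qed
  show ?thesis
    by (rule exI[of _ "1 / C"]) (use C main in auto)
qed

end
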